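(* Bourgain's Return Time Theorem does not hold for pairs of $(L^1,L^1)$ functions. That is, there exist a measure preserving system $(X,\mathcal{B},\mu,T)$ and a function $f\in L^1(\mu)$ such that it is not true that for $\mu$-a.e. $x\in X$ the sequence $(f(T^nx))_{n\ge1}$ is good universal for the pointwise ergodic theorem in $L^1$.
   Context: A measure preserving system $(X,\mathcal{B},\mu,T)$ (also called a dynamical system) consists of a probability space $(X,\mathcal{B},\mu)$ and an invertible measure preserving transformation $T$ of it. A sequence of scalars $(a_n)_{n\ge1}$ is good universal for the pointwise ergodic theorem in $L^r$, $1\le r\le\infty$, if for all dynamical systems $(Y,\mathcal{G},\nu,S)$ and all $g\in L^r(\nu)$ the averages $\frac1n\sum_{k=1}^n a_k\, g(S^ky)$ converge for $\nu$-a.e. $y$ as $n\to\infty$. *)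

theory Defs
  imports "HOL-Probability.Probability"
begin

locale dynamical_system = prob_space M for M :: "'a measure" +
  fixes T :: "'a \<Rightarrow> 'a"
  assumes measurable_T: "T \<in> measurable M M"
    and bij_T: "bij_betw T (space M) (space M)"
    and measurable_inv_T: "inv_into (space M) T \<in> measurable M M"
    and distr_T: "distr M M T = M"

text \<open>
  HOL cannot quantify over all types inside a formula, so the type carrying the test systems
  is an explicit argument. Within that type, all probability spaces (any underlying set, any
  sigma-algebra) are allowed. Lemma \<open>good_universal_L1_universal\<close> shows that the type
  \<open>int \<Rightarrow> real\<close> already accounts for the systems on every other type.
  The value of the sequence at 0 is irrelevant.
\<close>

definition good_universal_L1 :: "'b itself \<Rightarrow> (nat \<Rightarrow> real) \<Rightarrow> bool" where
  "good_universal_L1 _ a \<longleftrightarrow>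
     (\<forall>(N :: 'b measure) S g. dynamical_system N S \<longrightarrow> integrable N (g :: 'b \<Rightarrow> real) \<longrightarrow>
        (AE y in N. convergent (\<lambda>n. (\<Sum>k=1..n. a k * g ((S ^^ k) y)) / real n)))"

text \<open>
  A system together with a function \<open>f\<close> has the shift on two-sided real sequences as a factor,
  via the map sending \<open>x\<close> to its \<open>f\<close>-itinerary; \<open>f\<close> becomes the zeroth coordinate.
\<close>

lemma itinerary_factor:
  fixes M :: "'a measure" and f :: "'a \<Rightarrow> real"
  assumes "dynamical_system M T" and int_f: "integrable M f"
  obtains N :: "(int \<Rightarrow> real) measure" and S h \<phi> where
    "dynamical_system N S" "integrable N (h :: (int \<Rightarrow> real) \<Rightarrow> real)"
    "\<phi> \<in> measurable M N" "distr M N \<phi> = N"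
    "\<And>n x. x \<in> space M \<Longrightarrow> h ((S ^^ n) (\<phi> x)) = f ((T ^^ n) x)"
proof -
  interpret dynamical_system M T by fact
  define R where "R = inv_into (space M) T"
  define P :: "(int \<Rightarrow> real) measure" where "P = Pi\<^sub>M UNIV (\<lambda>_. borel)"
  define \<phi> :: "'a \<Rightarrow> int \<Rightarrow> real" where
    "\<phi> = (\<lambda>x k. if k \<ge> 0 then f ((T ^^ nat k) x) else f ((R ^^ nat (- k)) x))"
  define S :: "(int \<Rightarrow> real) \<Rightarrow> int \<Rightarrow> real" where "S = (\<lambda>z k. z (k + 1))"
  define S' :: "(int \<Rightarrow> real) \<Rightarrow> int \<Rightarrow> real" where "S' = (\<lambda>z k. z (k - 1))"
  define N where "N = distr M P \<phi>"
  have [measurable]: "T \<in> measurable M M" "R \<in> measurable M M" "f \<in> borel_measurable M"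
    using measurable_T measurable_inv_T int_f by (auto simp: R_def)
  have meas_pow [measurable]: "(T ^^ n) \<in> measurable M M" "(R ^^ n) \<in> measurable M M" for n
    by (rule measurable_compose_n, measurable)+
  have space_P [simp]: "space P = UNIV" by (simp add: P_def space_PiM)
  have \<phi>_meas [measurable]: "\<phi> \<in> measurable M P"
    unfolding P_def
  proof (rule measurable_PiM_single')
    fix i :: int
    show "(\<lambda>x. \<phi> x i) \<in> borel_measurable M"
      by (cases "i \<ge> 0") (simp_all add: \<phi>_def)
  qed auto
  have S_meas [measurable]: "S \<in> measurable P P" "S' \<in> measurable P P"
    unfolding P_def S_def S'_def by (rule measurable_PiM_single'; simp)+
  have RT: "T (R x) = x" if "x \<in> space M" for x
    using bij_T that by (simp add: R_def bij_betw_def f_inv_into_f)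
  have TR: "R (T x) = x" if "x \<in> space M" for x
    using bij_T that by (simp add: R_def bij_betw_def)
  have S_\<phi>: "S (\<phi> x) = \<phi> (T x)" if x: "x \<in> space M" for x
  proof
    fix k :: int
    consider "k \<ge> 0" | "k = -1" | "k < -1" by linarith
    then show "S (\<phi> x) k = \<phi> (T x) k"
    proof cases
      case 1
      then have "nat (k + 1) = Suc (nat k)" by simp
      with 1 show ?thesis by (simp add: S_def \<phi>_def funpow_swap1)
    next
      case 2
      then show ?thesis using TR[OF x] by (simp add: S_def \<phi>_def)
    next
      case 3
      then have "nat (- k) = Suc (nat (- (k + 1)))" by simp
      then have "(R ^^ nat (- k)) (T x) = (R ^^ nat (- (k + 1))) x"
        using TR[OF x] by (simp add: funpow_swap1)
      with 3 show ?thesis by (simp add: S_def \<phi>_def)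
    qed
  qed
  have sets_N [measurable_cong, simp]: "sets N = sets P" and space_N [simp]: "space N = UNIV"
    by (simp_all add: N_def)
  have SS: "S (S' z) = z" "S' (S z) = z" for z by (auto simp: S_def S'_def)
  have bij_S: "bij S" by (rule o_bij[of S']) (auto simp: SS)
  have inv_S: "inv S = S'" using SS by (intro inv_equality) auto
  have "distr N N S = distr N P S" by (rule distr_cong) auto
  also have "\<dots> = distr M P (S \<circ> \<phi>)" unfolding N_def by (rule distr_distr) auto
  also have "\<dots> = distr M P (\<phi> \<circ> T)" by (rule distr_cong) (auto simp: S_\<phi>)
  also have "\<dots> = distr (distr M M T) P \<phi>" by (rule distr_distr[symmetric]) auto
  also have "\<dots> = N" by (simp add: distr_T N_def)
  finally have distr_S: "distr N N S = N" .
  have sys: "dynamical_system N S"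
  proof (intro dynamical_system.intro dynamical_system_axioms.intro)
    show "prob_space N" unfolding N_def by (rule prob_space_distr) measurable
    show "S \<in> measurable N N" by measurable
    show "inv_into (space N) S \<in> measurable N N" unfolding space_N inv_S by measurable
  qed (use bij_S distr_S in auto)
  have "integrable N (\<lambda>z. z 0)"
  proof -
    have "(\<lambda>z. z 0) \<in> borel_measurable P" unfolding P_def by measurable
    then show ?thesis
      unfolding N_def using int_f integrable_distr_eq[OF \<phi>_meas, of "\<lambda>z. z 0"]
      by (simp add: \<phi>_def)
  qed
  moreover have "(S ^^ n) (\<phi> x) = \<phi> ((T ^^ n) x)" if "x \<in> space M" for n x
  proof (induction n)
    case (Suc n)
    have "(T ^^ n) x \<in> space M" using that measurable_space[OF meas_pow(1)] by blast
    with Suc show ?case by (simp add: S_\<phi>)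
  qed simp
  then have "(S ^^ n) (\<phi> x) 0 = f ((T ^^ n) x)" if "x \<in> space M" for n x
    using that by (simp add: \<phi>_def)
  moreover have "\<phi> \<in> measurable M N" by measurable
  moreover have "distr M N \<phi> = N" unfolding N_def by (rule distr_cong) auto
  ultimately show thesis using sys that[of N S "\<lambda>z. z 0" \<phi>] by simp
qed

lemma good_universal_L1_universal:
  assumes "good_universal_L1 TYPE(int \<Rightarrow> real) a"
  shows "good_universal_L1 TYPE('b) a"
  unfolding good_universal_L1_def
proof (intro allI impI)
  fix M :: "'b measure" and T and f :: "'b \<Rightarrow> real"
  assume "dynamical_system M T" "integrable M f"
  then obtain N :: "(int \<Rightarrow> real) measure" and S h \<phi> where
    N: "dynamical_system N S" "integrable N (h :: (int \<Rightarrow> real) \<Rightarrow> real)"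
      "\<phi> \<in> measurable M N" "distr M N \<phi> = N"
      "\<And>n x. x \<in> space M \<Longrightarrow> h ((S ^^ n) (\<phi> x)) = f ((T ^^ n) x)"
    by (rule itinerary_factor) blast
  have "AE y in distr M N \<phi>. convergent (\<lambda>n. (\<Sum>k=1..n. a k * h ((S ^^ k) y)) / real n)"
    using assms N(1,2) by (simp add: good_universal_L1_def N(4))
  from AE_distrD[OF N(3) this]
  show "AE x in M. convergent (\<lambda>n. (\<Sum>k=1..n. a k * f ((T ^^ k) x)) / real n)"
    using AE_space by eventually_elim (simp add: N(5))
qed

text \<open>
  Likewise, a system on any type for which the return times property fails yields one
  on \<open>int \<Rightarrow> real\<close>.
\<close>

lemma return_times_failure_transfer:
  fixes M :: "'a measure" and f :: "'a \<Rightarrow> real"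
  assumes "dynamical_system M T" "integrable M f"
    and bad: "\<not> (AE x in M. good_universal_L1 TYPE('b) (\<lambda>n. f ((T ^^ n) x)))"
  shows "\<exists>(N :: (int \<Rightarrow> real) measure) S h. dynamical_system N S \<and> integrable N h \<and>
    \<not> (AE z in N. good_universal_L1 TYPE('b) (\<lambda>n. h ((S ^^ n) z)))"
proof -
  from assms(1,2) obtain N :: "(int \<Rightarrow> real) measure" and S h \<phi> where
    N: "dynamical_system N S" "integrable N (h :: (int \<Rightarrow> real) \<Rightarrow> real)"
      "\<phi> \<in> measurable M N" "distr M N \<phi> = N"
      "\<And>n x. x \<in> space M \<Longrightarrow> h ((S ^^ n) (\<phi> x)) = f ((T ^^ n) x)"
    by (rule itinerary_factor) blast
  have "\<not> (AE z in N. good_universal_L1 TYPE('b) (\<lambda>n. h ((S ^^ n) z)))"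
  proof
    assume "AE z in N. good_universal_L1 TYPE('b) (\<lambda>n. h ((S ^^ n) z))"
    then have "AE z in distr M N \<phi>. good_universal_L1 TYPE('b) (\<lambda>n. h ((S ^^ n) z))"
      unfolding N(4) .
    from AE_distrD[OF N(3) this]
    have "AE x in M. good_universal_L1 TYPE('b) (\<lambda>n. f ((T ^^ n) x))"
      using AE_space by eventually_elim (simp add: N(5))
    with bad show False ..
  qed
  with N(1,2) show ?thesis by blast
qed

end

theory Submission
  imports Defs
begin

text \<open>
  For a nonnegative sequence \<open>a\<close> let \<open>N(\<tau>)\<close> be the number of \<open>k \<ge> 1\<close> with \<open>a k > k / \<tau>\<close>. If \<open>N(\<tau>) / \<tau>\<close>
  is unbounded, then some probability law on the nonnegative reals has finite mean although
  \<open>N(G)\<close> has infinite mean for a variable \<open>G\<close> with this law, and an i.i.d. sequence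
  \<open>g\<close> of such variables almost surely satisfies
  \<open>a k * g k > k\<close> for infinitely many \<open>k\<close>. So the averages of \<open>a k * g k\<close> diverge
  (\<open>unbounded_hits_not_good_universal\<close>). It remains to find an integrable \<open>f\<close> such that
  \<open>N(\<tau>) / \<tau>\<close> is unbounded for \<open>a k = f (T ^ k x)\<close>, for almost all \<open>x\<close>
  (\<open>system_with_unbounded_hits\<close>).

  Such an \<open>f\<close> is put together, in a product of finite rotations, from finite words whose mean is
  small compared with the ratio \<open>N(\<tau>) / \<tau>\<close> that most of their positions attain. For spikes of height
  \<open>v\<close>, the count up to \<open>\<tau>\<close> is the number of spikes in a window of length \<open>v * \<tau>\<close>. Thus one and the
  same \<open>\<tau>\<close> tests spikes of different heights on windows of very different lengths, and this is what
  the construction exploits. Let the density of the spikes of height \<open>v\<close> evolve, from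
  coarse to fine scales, like the capital of a gambler who doubles or loses everything in fair bets.
  The mean of the final word is the initial capital. A point \<open>x\<close> for which a bet is lost still sees,
  in its long window, the density before the bet, that is the highest capital \<open>2 ^ l\<close> that was reached
  there. At the much finer scales that matter for smaller spikes the loss is already visible, and a new
  gambler with far smaller spikes can start just where the previous one was ruined. Hence the
  points collect the maxima of successive gamblers, simultaneously for a single \<open>\<tau>\<close>. The maximum of a
  gambler who stops after \<open>L\<close> doublings has expectation \<open>(L + 2) / 2\<close>, against an initial capital of
  \<open>1\<close>, so the gain is unbounded as \<open>L\<close> grows (\<open>abundant_graft_left\<close>, \<open>achievable_bound\<close>).
\<close>

section \<open>Words with many hits and small mean\<close>

text \<open>
  A word is a function \<open>f\<close> read on \<open>{..<N}\<close>; positions past the end count for nothing, so that a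
  word keeps its hits wherever it is placed inside a longer one. The strictness of the inequality
  \<open>k < t * f (x + k)\<close> makes the count scale without loss: if every letter is repeated \<open>P\<close> times,
  each hit at time \<open>t\<close> gives \<open>P\<close> hits at time \<open>P * t\<close>.
\<close>

definition hits :: "(nat \<Rightarrow> nat) \<Rightarrow> nat \<Rightarrow> nat \<Rightarrow> nat \<Rightarrow> nat set" where
  "hits f N x t = {k. 1 \<le> k \<and> x + k < N \<and> k + 1 \<le> t * f (x + k)}"

text \<open>
  The factor \<open>2\<close> absorbs once and for all the discretisation losses of the construction, so that
  they do not accumulate over its steps.
\<close>

definition abundant :: "(nat \<Rightarrow> nat) \<Rightarrow> nat \<Rightarrow> nat \<Rightarrow> nat \<Rightarrow> bool" where
  "abundant f N n x \<longleftrightarrow> (\<exists>t\<ge>1. n * t \<le> 2 * card (hits f N x t))"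

text \<open>
  \<open>E\<close> is the price, as the mean of the word, at which nearly all positions can be made abundant to
  degree \<open>n\<close>. The point is that the price of a large \<open>n\<close> can be far below \<open>n\<close>.
\<close>

definition achievable :: "nat \<Rightarrow> real \<Rightarrow> bool" where
  "achievable n E \<longleftrightarrow> (\<forall>\<epsilon>>0. \<exists>N>0. \<exists>f.
     real (\<Sum>x<N. f x) \<le> E * N \<and> real (card {x. x < N \<and> \<not> abundant f N n x}) \<le> \<epsilon> * N)"

lemma finite_hits [simp]: "finite (hits f N x t)"
  by (rule finite_subset[of _ "{..<N}"]) (auto simp: hits_def)

lemma sum_lessThan_add: "(\<Sum>x<m + n. g x) = (\<Sum>x<m. g x) + (\<Sum>x<n. g (m + x))"
  for g :: "nat \<Rightarrow> 'a::comm_monoid_add"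
  by (induction n) (simp_all add: add.assoc)

lemma sum_lessThan_mult: "(\<Sum>x<M * P. g x) = (\<Sum>q<M. \<Sum>r<P. g (q * P + r))"
  for g :: "nat \<Rightarrow> 'a::comm_monoid_add"
proof (induction M)
  case (Suc M)
  have "(\<Sum>x<Suc M * P. g x) = (\<Sum>x<M * P + P. g x)" by (simp add: add.commute)
  then show ?case unfolding sum_lessThan_add Suc by simp
qed simp

lemma card_eq_sum_of_bool: "card {x. x < N \<and> p x} = (\<Sum>x<N. of_bool (p x))" for N :: nat
  by (simp add: of_bool_def if_distrib sum.If_cases Int_def)

lemma achievable_0: "achievable 0 0"
  unfolding achievable_def
proof (intro allI impI exI[of _ 1] exI[of _ "\<lambda>_. 0"] conjI)
  have "abundant f N 0 x" for f N x by (auto simp: abundant_def)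
  then show "real (card {x. x < 1 \<and> \<not> abundant (\<lambda>_. 0) 1 0 x}) \<le> \<epsilon> * real 1" if "\<epsilon> > 0" for \<epsilon>
    using that by simp
qed auto

text \<open>
  One period of the grafted word has length \<open>2 * Q * P\<close>. Its first half is the word \<open>f\<close> (of length
  \<open>Q\<close>) with every letter repeated \<open>P\<close> times, its second half consists of \<open>Q\<close> copies of the word \<open>W\<close>
  (of length \<open>P\<close>). The two halves play the two outcomes of a fair bet: in the first one the spikes
  of \<open>W\<close> are lost and replaced by \<open>f\<close>, in the second one they are kept.
\<close>

definition graft :: "(nat \<Rightarrow> nat) \<Rightarrow> nat \<Rightarrow> (nat \<Rightarrow> nat) \<Rightarrow> nat \<Rightarrow> nat \<Rightarrow> nat" where
  "graft f Q W P x = (let j = (x div P) mod (2 * Q) in if j < Q then f j else W (x mod P))"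

lemma graft_eq:
  assumes "r < P" "j < 2 * Q"
  shows "graft f Q W P ((i * (2 * Q) + j) * P + r) = (if j < Q then f j else W r)"
  using assms by (auto simp: graft_def Let_def)

lemma sum_graft_blocks:
  fixes g :: "nat \<Rightarrow> 'a::comm_monoid_add"
  shows "(\<Sum>x<K * (2 * Q) * P. g x) =
    (\<Sum>i<K. (\<Sum>j<Q. \<Sum>r<P. g ((i * (2 * Q) + j) * P + r)) + (\<Sum>j<Q. \<Sum>r<P. g ((i * (2 * Q) + (Q + j)) * P + r)))"
  unfolding sum_lessThan_mult mult_2 sum_lessThan_add ..

lemma sum_graft:
  "(\<Sum>x<K * (2 * Q) * P. graft f Q W P x) = K * (P * (\<Sum>j<Q. f j) + Q * (\<Sum>r<P. W r))"
  unfolding sum_graft_blocks by (simp add: graft_eq sum_distrib_left)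

lemma graft_density:
  "K * (Q * card {r. r < P \<and> v \<le> W r}) \<le> card {x. x < K * (2 * Q) * P \<and> v \<le> graft f Q W P x}"
  unfolding card_eq_sum_of_bool sum_graft_blocks by (simp add: graft_eq)

text \<open>
  Inside a copy of \<open>W\<close> nothing changes, because hits of a word only look inside that word.
\<close>

lemma abundant_graft_right:
  assumes "i < K" "Q \<le> j" "j < 2 * Q" "r < P" "abundant W P n r"
  shows "abundant (graft f Q W P) (K * (2 * Q) * P) n ((i * (2 * Q) + j) * P + r)"
proof -
  let ?x = "(i * (2 * Q) + j) * P + r" and ?N = "K * (2 * Q) * P"
  obtain t where t: "t \<ge> 1" "n * t \<le> 2 * card (hits W P r t)"
    using assms(5) by (auto simp: abundant_def)
  have "i * (2 * Q) + j < K * (2 * Q)"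
    using mult_le_mono1[of "Suc i" K "2 * Q"] assms by auto
  then have le: "(i * (2 * Q) + j) * P + P \<le> ?N"
    using mult_le_mono1[of "Suc (i * (2 * Q) + j)" "K * (2 * Q)" P] by (simp add: algebra_simps)
  have "hits W P r t \<subseteq> hits (graft f Q W P) ?N ?x t"
  proof
    fix k assume k: "k \<in> hits W P r t"
    then have "graft f Q W P (?x + k) = W (r + k)"
      using graft_eq[of "r + k" P j Q f W i] assms by (simp add: hits_def add.assoc)
    with k le show "k \<in> hits (graft f Q W P) ?N ?x t"
      by (auto simp: hits_def)
  qed
  then have "card (hits W P r t) \<le> card (hits (graft f Q W P) ?N ?x t)"
    by (intro card_mono) auto
  with t show ?thesis unfolding abundant_def by (intro exI[of _ t]) auto
qed

text \<open>
  The step that produces more hits than the mean pays for. At a position in the ruined half, at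
  time \<open>P * t\<close>, two kinds of hits are added up. The letters of \<open>f\<close>, which are at most \<open>B\<close>, give hits
  at distance below \<open>P * t * B\<close>; this is the stretched count of \<open>f\<close>. The spikes of height \<open>v\<close> give
  hits at distances up to \<open>P * t * v\<close>, and as \<open>v\<close> is huge this window runs over many whole periods,
  so that it sees the average spike density over both halves, although \<open>x\<close> itself lies in
  the half without spikes. The spikes are counted only from distance \<open>P * t * B\<close> on, which keeps the
  two kinds disjoint. The hypothesis \<open>i + v * tm < K\<close> ensures that the window does not run past the
  end of the word.
\<close>

lemma abundant_graft_left:
  assumes P: "P > 0" and i: "i + v * tm < K" and j: "j < Q" and r: "r < P"
    and B: "\<And>j. j < Q \<Longrightarrow> f j \<le> B"
    and t: "t \<ge> 1" "t \<le> tm" "(n - a) * t \<le> 2 * card (hits f Q j t)"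
    and v: "4 * Q * (2 + B) \<le> v"
    and dens: "2 * a * P \<le> v * card {r. r < P \<and> v \<le> W r}"
  shows "abundant (graft f Q W P) (K * (2 * Q) * P) n ((i * (2 * Q) + j) * P + r)"
proof -
  define F where "F = graft f Q W P"
  define N where "N = K * (2 * Q) * P"
  define x where "x = (i * (2 * Q) + j) * P + r"
  define w where "w = card {r. r < P \<and> v \<le> W r}"
  define D where "D = 2 * Q * P"
  define m where "m = (t * v) div (2 * Q)"
  \<comment> \<open>The \<open>c\<close> periods with numbers \<open>i1, \<dots>, i1 + c - 1\<close> lie wholly inside the window of the spikes
    and beyond that of \<open>f\<close>.\<close>
  define i1 where "i1 = i + 1 + t * B"
  define c where "c = m - 1 - t * B"
  have Q: "Q > 0" using j by simp
  have m_le: "m * (2 * Q) \<le> t * v" and m_gt: "t * v < m * (2 * Q) + 2 * Q"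
    using Q dividend_less_div_times[of "2 * Q" "t * v"] by (simp_all add: m_def)
  have "4 * Q * (2 + B) * t \<le> v * t" using v by simp
  then have "8 * Q * t + 4 * Q * (t * B) \<le> t * v" by (simp add: algebra_simps)
  moreover have "8 * Q \<le> 8 * Q * t" using t(1) by simp
  ultimately have tv: "8 * Q + 4 * Q * (t * B) \<le> t * v" by linarith
  have c_big: "t * v \<le> 4 * Q * c" and m_eq: "m = c + 1 + t * B"
  proof -
    have "t * v + t * v < 4 * Q * m + 4 * Q" using m_gt by (simp add: algebra_simps)
    with tv have *: "t * v + 4 * Q * (t * B + 1) < 4 * Q * m" by (simp add: algebra_simps)
    then have "4 * Q * (t * B + 1) < 4 * Q * m" by linarith
    then have "t * B + 1 < m" using nat_mult_less_cancel_disj by blast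
    then show m: "m = c + 1 + t * B" by (simp add: c_def)
    show "t * v \<le> 4 * Q * c" using * unfolding m by (simp add: algebra_simps)
  qed
  have "m \<le> m * (2 * Q)" using Q by simp
  also have "\<dots> \<le> v * tm" using m_le t(2) by (metis le_trans mult.commute mult_le_mono1)
  finally have i2: "i1 + c \<le> K" using i m_eq by (simp add: i1_def)
  have x_lo: "i * D \<le> x" by (simp add: x_def D_def algebra_simps)
  have "j * P + r < Q * P" using r j mult_le_mono1[of "Suc j" Q P] by simp
  then have x_hi: "x < (i + 1) * D" by (simp add: x_def D_def algebra_simps)
  define inner where "inner = (\<lambda>(k, s). k * P + s - r) ` (hits f Q j t \<times> {..<P})"
  define outer where "outer = (\<lambda>y. y - x) ` {y. y \<in> {i1 * D..<(i1 + c) * D} \<and> v \<le> F y}"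
  \<comment> \<open>A hit \<open>k\<close> of \<open>f\<close> has \<open>P\<close> stretched copies, at the positions \<open>(j + k) * P + s\<close> relative to the
    start of the period; \<open>r\<close> is subtracted since \<open>x\<close> sits at offset \<open>r\<close> in its own letter.\<close>
  have inner_bound: "k * P + s - r + 1 \<le> P * t * f (j + k) \<and> 1 \<le> k * P + s - r \<and> r \<le> k * P + s"
    if "k \<in> hits f Q j t" "s < P" for k s
  proof -
    have k: "1 \<le> k" "k + 1 \<le> t * f (j + k)" using that by (auto simp: hits_def)
    have "P * (k + 1) \<le> P * (t * f (j + k))" using k(2) by (rule mult_le_mono2)
    then have "k * P + P \<le> P * t * f (j + k)" by (simp add: algebra_simps)
    moreover have "P \<le> k * P" using k(1) by simp
    ultimately show ?thesis using r that(2) by linarith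
  qed
  have inner_sub: "inner \<subseteq> hits F N x (P * t)"
  proof
    fix y assume "y \<in> inner"
    then obtain k s where y: "y = k * P + s - r" and k: "k \<in> hits f Q j t" and s: "s < P"
      by (auto simp: inner_def)
    note b = inner_bound[OF k s]
    have jk: "j + k < Q" using k by (simp add: hits_def)
    have xy: "x + y = (i * (2 * Q) + (j + k)) * P + s"
      using b by (simp add: y x_def algebra_simps)
    have F: "F (x + y) = f (j + k)" unfolding xy F_def using s jk by (subst graft_eq) auto
    have "(j + k) * P + s < Q * P" using s jk mult_le_mono1[of "Suc (j + k)" Q P] by simp
    moreover have "(i + 1) * (2 * Q) * P \<le> N" unfolding N_def using i by (intro mult_le_mono1) auto
    ultimately have "x + y < N" unfolding xy by (simp add: algebra_simps)
    with b F show "y \<in> hits F N x (P * t)" by (simp add: hits_def y)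
  qed
  have outer_sub: "outer \<subseteq> hits F N x (P * t)"
  proof
    fix z assume "z \<in> outer"
    then obtain y where z: "z = y - x" and y: "i1 * D \<le> y" "y < (i1 + c) * D" "v \<le> F y"
      by (auto simp: outer_def)
    have "(i + 1) * D \<le> i1 * D" by (intro mult_le_mono1) (simp add: i1_def)
    with y x_hi have xy: "x < y" by linarith
    have "(i1 + c) * D \<le> N" using mult_le_mono1[OF i2, of D] by (simp add: N_def D_def algebra_simps)
    moreover have "(i1 + c) * D = i * D + m * (2 * Q) * P"
      by (simp add: i1_def m_eq D_def algebra_simps)
    moreover have "m * (2 * Q) * P \<le> t * v * P" using m_le by (rule mult_le_mono1)
    moreover have "t * v * P \<le> P * t * F y" using y(3) by simp
    ultimately have "y < N" "y - x + 1 \<le> P * t * F y" "1 \<le> y - x"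
      using y x_lo xy by linarith+
    then show "z \<in> hits F N x (P * t)" using xy by (simp add: hits_def z)
  qed
  have disj: "inner \<inter> outer = {}"
  proof -
    have "k * P + s - r \<noteq> y - x" if "k \<in> hits f Q j t" "s < P" "i1 * D \<le> y" for k s y
    proof -
      have jk: "j + k < Q" using that by (simp add: hits_def)
      have "P * t * f (j + k) \<le> P * t * B" using B[OF jk] by (rule mult_le_mono2)
      moreover have "P * t * B \<le> t * B * D" using Q by (simp add: D_def algebra_simps)
      moreover have "i1 * D = (i + 1) * D + t * B * D" by (simp add: i1_def algebra_simps)
      ultimately show ?thesis using inner_bound[OF that(1,2)] x_hi that(3) by linarith
    qed
    then show ?thesis by (auto simp: inner_def outer_def)
  qed
  have card_inner: "card inner = P * card (hits f Q j t)"
  proof -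
    have "inj_on (\<lambda>(k, s). k * P + s - r) (hits f Q j t \<times> {..<P})"
    proof (rule inj_onI, clarsimp)
      fix k s k' s'
      assume *: "k \<in> hits f Q j t" "s < P" "k' \<in> hits f Q j t" "s' < P" "k * P + s - r = k' * P + s' - r"
      then have "k * P + s = k' * P + s'"
        using inner_bound[of k s] inner_bound[of k' s'] by linarith
      then have "(k * P + s) div P = (k' * P + s') div P \<and> (k * P + s) mod P = (k' * P + s') mod P" by simp
      then show "k = k' \<and> s = s'" using * by simp
    qed
    then show ?thesis by (simp add: inner_def card_image card_cartesian_product)
  qed
  have card_outer: "c * (Q * w) \<le> card outer"
  proof -
    have "c * (Q * w) \<le> card {y. y < c * (2 * Q) * P \<and> v \<le> F y}"
      unfolding F_def w_def by (rule graft_density)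
    also have "\<dots> = card ((\<lambda>y. i1 * D + y - x) ` {y. y < c * (2 * Q) * P \<and> v \<le> F y})"
    proof (rule card_image[symmetric], rule inj_onI)
      have "(i + 1) * D \<le> i1 * D" by (intro mult_le_mono1) (simp add: i1_def)
      then show "y = y'" if "i1 * D + y - x = i1 * D + y' - x" for y y'
        using that x_hi by linarith
    qed
    also have "\<dots> \<le> card outer"
    proof (rule card_mono)
      show "finite outer" by (simp add: outer_def)
      have per: "F (i1 * D + y) = F y" for y
      proof -
        have "(i1 * D + y) div P = i1 * (2 * Q) + y div P"
          using P by (simp add: D_def mult.assoc[symmetric] div_mult_self3)
        moreover have "(i1 * D + y) mod P = y mod P" by (simp add: D_def mult.assoc[symmetric])
        ultimately show ?thesis by (simp add: F_def graft_def Let_def)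
      qed
      have "i1 * D + y \<in> {y. y \<in> {i1 * D..<(i1 + c) * D} \<and> v \<le> F y}" if "y < c * (2 * Q) * P" "v \<le> F y" for y
        using that unfolding mem_Collect_eq per by (simp add: D_def algebra_simps)
      then show "(\<lambda>y. i1 * D + y - x) ` {y. y < c * (2 * Q) * P \<and> v \<le> F y} \<subseteq> outer"
        unfolding outer_def by blast
    qed
    finally show ?thesis .
  qed
  have "finite inner" "finite outer" by (auto simp: inner_def outer_def)
  then have "card inner + card outer = card (inner \<union> outer)" using disj by (simp add: card_Un_disjoint)
  also have "\<dots> \<le> card (hits F N x (P * t))" using inner_sub outer_sub by (intro card_mono) auto
  finally have total: "card inner + card outer \<le> card (hits F N x (P * t))" .
  have "a * (P * t) \<le> 2 * (c * (Q * w))"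
  proof -
    have "v > 0" using v Q by (auto intro: Nat.gr0I)
    have "2 * a * P * (t * v) \<le> (v * w) * (4 * Q * c)"
      using dens c_big unfolding w_def by (rule mult_le_mono)
    then have "(2 * v) * (a * (P * t)) \<le> (2 * v) * (2 * (c * (Q * w)))" by (simp add: algebra_simps)
    with \<open>v > 0\<close> show ?thesis by (simp add: ac_simps)
  qed
  moreover have "(n - a) * (P * t) \<le> 2 * (P * card (hits f Q j t))"
    using mult_le_mono2[OF t(3), of P] by (simp add: algebra_simps)
  moreover have "n * (P * t) \<le> (n - a) * (P * t) + a * (P * t)"
    by (simp only: add_mult_distrib[symmetric]) (rule mult_le_mono1, simp)
  ultimately have "n * (P * t) \<le> 2 * card (hits F N x (P * t))"
    using total card_inner card_outer by linarith
  moreover have "P * t \<ge> 1" using P t(1) by simp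
  ultimately show ?thesis unfolding abundant_def F_def N_def x_def by blast
qed


lemma bad_graft:
  assumes P: "P > 0"
    and B: "\<And>j. j < Q \<Longrightarrow> f j \<le> B"
    and tm: "\<And>j. j < Q \<Longrightarrow> abundant f Q (n - a) j \<Longrightarrow> \<exists>t\<ge>1. t \<le> tm \<and> (n - a) * t \<le> 2 * card (hits f Q j t)"
    and v: "4 * Q * (2 + B) \<le> v"
    and dens: "2 * a * P \<le> v * card {r. r < P \<and> v \<le> W r}"
  shows "card {x. x < K * (2 * Q) * P \<and> \<not> abundant (graft f Q W P) (K * (2 * Q) * P) n x} \<le>
    K * P * card {j. j < Q \<and> \<not> abundant f Q (n - a) j} + K * Q * card {r. r < P \<and> \<not> abundant W P n r}
    + v * tm * (Q * P)"
proof -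
  define bad where "bad x \<longleftrightarrow> \<not> abundant (graft f Q W P) (K * (2 * Q) * P) n x" for x
  define p where "p j \<longleftrightarrow> \<not> abundant f Q (n - a) j" for j
  define q where "q r \<longleftrightarrow> \<not> abundant W P n r" for r
  have left: "of_bool (bad ((i * (2 * Q) + j) * P + r)) \<le> (of_bool (p j) + of_bool (K \<le> i + v * tm) :: nat)"
    if "i < K" "j < Q" "r < P" for i j r
  proof (cases "abundant f Q (n - a) j \<and> i + v * tm < K")
    case True
    then obtain t where "t \<ge> 1" "t \<le> tm" "(n - a) * t \<le> 2 * card (hits f Q j t)"
      using tm \<open>j < Q\<close> by blast
    with True abundant_graft_left[of P i v tm K j Q r f B t n a W] P that B v dens
    show ?thesis by (simp add: bad_def)
  qed (auto simp: p_def)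
  have right: "of_bool (bad ((i * (2 * Q) + (Q + j)) * P + r)) \<le> (of_bool (q r) :: nat)"
    if "i < K" "j < Q" "r < P" for i j r
    using abundant_graft_right[of i K Q "Q + j" r P W n f] that by (auto simp: bad_def q_def)
  have late: "(\<Sum>i<K. of_bool (K \<le> i + v * tm)) \<le> v * tm"
  proof -
    have "(\<Sum>i<K. of_bool (K \<le> i + v * tm)) = card {i. i < K \<and> K \<le> i + v * tm}"
      by (rule card_eq_sum_of_bool[symmetric])
    also have "\<dots> \<le> card {K - v * tm..<K}" by (intro card_mono) auto
    finally show ?thesis by simp
  qed
  have "card {x. x < K * (2 * Q) * P \<and> bad x} \<le>
     (\<Sum>i<K. (\<Sum>j<Q. \<Sum>r<P. of_bool (p j) + of_bool (K \<le> i + v * tm)) + (\<Sum>j<Q. \<Sum>r<P. of_bool (q r)))"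
    unfolding card_eq_sum_of_bool sum_graft_blocks
    by (intro sum_mono add_mono left right) auto
  also have "\<dots> = K * (P * (\<Sum>j<Q. of_bool (p j))) + K * (Q * (\<Sum>r<P. of_bool (q r)))
      + Q * P * (\<Sum>i<K. of_bool (K \<le> i + v * tm))"
    by (simp add: sum.distrib sum_distrib_left algebra_simps del: sum_of_bool_eq)
  also have "\<dots> \<le> K * (P * (\<Sum>j<Q. of_bool (p j))) + K * (Q * (\<Sum>r<P. of_bool (q r))) + Q * P * (v * tm)"
    using late by (intro add_left_mono mult_left_mono) auto
  finally show ?thesis
    unfolding card_eq_sum_of_bool bad_def p_def q_def by (simp add: algebra_simps)
qed

text \<open>
  The intermediate words for a fixed target \<open>n\<close>: spikes of height \<open>v\<close> have density at least \<open>a / v\<close>,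
  so that a window of length \<open>t * v\<close> contains about \<open>a * t\<close> of them, and \<open>a\<close> is the capital of the gambler.
\<close>

definition stage :: "nat \<Rightarrow> nat \<Rightarrow> nat \<Rightarrow> real \<Rightarrow> real \<Rightarrow> bool" where
  "stage n v a D \<epsilon> \<longleftrightarrow> (\<exists>P>0. \<exists>W.
     a * P \<le> v * card {r. r < P \<and> v \<le> W r} \<and> real (\<Sum>r<P. W r) \<le> D * P \<and>
     real (card {r. r < P \<and> \<not> abundant W P n r}) \<le> \<epsilon> * P)"

lemma stage_mono:
  assumes "stage n v a D \<epsilon>" "D \<le> D'"
  shows "stage n v a D' \<epsilon>"
proof -
  obtain P W where "P > 0" "a * P \<le> v * card {r. r < P \<and> v \<le> W r}"
    "real (\<Sum>r<P. W r) \<le> D * P" "real (card {r. r < P \<and> \<not> abundant W P n r}) \<le> \<epsilon> * P"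
    using assms(1) unfolding stage_def by blast
  moreover have "D * real P \<le> D' * real P" using assms(2) by (rule mult_right_mono) simp
  ultimately show ?thesis unfolding stage_def by (intro exI[of _ P] conjI exI[of _ W]) linarith+
qed

text \<open>
  The end of a winning streak: the capital \<open>a\<close> has reached the target \<open>n\<close>, and equidistant spikes
  alone suffice.
\<close>

lemma stage_top:
  assumes d: "d > 0" and a: "a \<ge> 2" "n \<le> a" and \<epsilon>: "\<epsilon> > 0"
  shows "stage n (a * d) a a \<epsilon>"
proof -
  define v where "v = a * d"
  define R where "R = nat \<lceil>1 / \<epsilon>\<rceil>"
  have R: "1 / \<epsilon> \<le> R" unfolding R_def by linarith
  with \<epsilon> have "R > 0" by (auto intro!: Nat.gr0I)
  have R\<epsilon>: "1 \<le> \<epsilon> * R" using R \<epsilon> by (simp add: field_simps)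
  define P where "P = (R * a) * d"
  define W where "W = (\<lambda>x. if x mod d = 0 then v else 0)"
  have v: "v > 0" using d a by (simp add: v_def)
  have P: "P > 0" "P = R * v" using d a \<open>R > 0\<close> by (auto simp: P_def v_def)
  have one: "(\<Sum>r<d. if r = 0 then c else 0) = c" for c :: nat
    using d by (subst sum.delta) auto
  have "card {r. r < P \<and> v \<le> W r} = R * a"
    using v unfolding card_eq_sum_of_bool P_def sum_lessThan_mult
    by (simp add: W_def of_bool_def if_distrib one cong: if_cong)
  then have 1: "a * P \<le> v * card {r. r < P \<and> v \<le> W r}" by (simp add: P)
  have "(\<Sum>r<P. W r) = R * a * v"
    unfolding P_def sum_lessThan_mult by (simp add: W_def one)
  then have 2: "real (\<Sum>r<P. W r) \<le> real a * P" by (simp add: P)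
  have "abundant W P n x" if x: "x + v < P" for x
  proof -
    define y where "y = x div d"
    have y: "d * y \<le> x" "x < d * y + d"
      using dividend_less_times_div[OF d, of x] by (simp_all add: y_def add.commute)
    let ?h = "\<lambda>i. d * (y + i) - x"
    have "?h ` {1..<a} \<subseteq> hits W P x 1"
    proof clarsimp
      fix i assume i: "Suc 0 \<le> i" "i < a"
      have "d * y + d \<le> d * (y + i)" using mult_le_mono2[OF i(1), of d] by (simp add: algebra_simps)
      moreover have "d * (y + i) + d \<le> d * y + v"
        using mult_le_mono2[of "Suc i" a d] i(2) by (simp add: v_def algebra_simps)
      moreover define z where "z = d * (y + i)"
      ultimately have "1 \<le> z - x" "x \<le> z" "z - x + 1 \<le> v" "z < P"
        using x y d by linarith+
      moreover have "W z = v" by (simp add: W_def z_def)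
      ultimately show "d * (y + i) - x \<in> hits W P x (Suc 0)"
        unfolding z_def[symmetric] by (simp add: hits_def)
    qed
    then have "card (?h ` {1..<a}) \<le> card (hits W P x 1)" by (intro card_mono) auto
    moreover have "inj_on ?h {1..<a}"
    proof (rule inj_onI)
      fix i j assume ij: "i \<in> {1..<a}" "j \<in> {1..<a}" "?h i = ?h j"
      have "x < d * (y + k)" if "1 \<le> k" for k
      proof -
        have "d \<le> d * k" using that by simp
        with y show ?thesis unfolding distrib_left by linarith
      qed
      with ij have "d * (y + i) = d * (y + j)"
        by (metis atLeastLessThan_iff eq_diff_iff less_imp_le)
      with d show "i = j" by simp
    qed
    ultimately have "a - 1 \<le> card (hits W P x 1)" by (simp add: card_image)
    then show ?thesis using a unfolding abundant_def by (intro exI[of _ 1]) auto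
  qed
  then have "card {r. r < P \<and> \<not> abundant W P n r} \<le> card {P - v..<P}"
    by (intro card_mono subsetI) (simp_all, metis less_diff_conv not_less)
  then have "real (card {r. r < P \<and> \<not> abundant W P n r}) \<le> real v" by simp
  also have "\<dots> \<le> \<epsilon> * P" using mult_right_mono[OF R\<epsilon>, of "real v"] by (simp add: P mult.assoc)
  finally show ?thesis using 1 2 P(1) unfolding stage_def v_def by blast
qed

lemma abundant_times_bounded:
  "\<exists>tm. \<forall>j<Q. abundant f Q n j \<longrightarrow> (\<exists>t\<ge>1. t \<le> tm \<and> n * t \<le> 2 * card (hits f Q j t))"
proof -
  have "\<forall>j. \<exists>t. abundant f Q n j \<longrightarrow> t \<ge> 1 \<and> n * t \<le> 2 * card (hits f Q j t)"
    unfolding abundant_def by blast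
  then obtain \<tau> where \<tau>: "\<And>j. abundant f Q n j \<Longrightarrow> \<tau> j \<ge> 1 \<and> n * \<tau> j \<le> 2 * card (hits f Q j (\<tau> j))"
    by metis
  have "\<tau> j \<le> (\<Sum>j<Q. \<tau> j)" if "j < Q" for j using that by (intro member_le_sum) auto
  with \<tau> show ?thesis by blast
qed

text \<open>
  One bet, read backwards: a word for capital \<open>a\<close> arises from one for the doubled capital, after a
  win, and from a word for the remaining target \<open>n - a\<close>, after a loss. A point in the losing half has
  collected \<open>a\<close>, and its cost is that of the remaining target. The number \<open>K\<close> of periods
  is so large that the periods lost at the right end make up a fraction of at most \<open>\<delta>\<close>.
\<close>

lemma stage_step:
  assumes W: "stage n v (2 * a) D (\<epsilon> + \<delta>)"
    and Q: "Q > 0" "\<And>j. j < Q \<Longrightarrow> f j \<le> B" "4 * Q * (2 + B) \<le> v"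
    and f: "real (\<Sum>j<Q. f j) \<le> E * Q" "real (card {j. j < Q \<and> \<not> abundant f Q (n - a) j}) \<le> \<epsilon> * Q"
    and \<delta>: "\<delta> > 0" and D': "(E + D) / 2 \<le> D'"
  shows "stage n v a D' (\<epsilon> + \<delta>)"
proof -
  obtain P W where P: "P > 0" and dens: "2 * a * P \<le> v * card {r. r < P \<and> v \<le> W r}"
    and sumW: "real (\<Sum>r<P. W r) \<le> D * P" and badW: "real (card {r. r < P \<and> \<not> abundant W P n r}) \<le> (\<epsilon> + \<delta>) * P"
    using W unfolding stage_def by blast
  obtain tm where tm: "\<And>j. j < Q \<Longrightarrow> abundant f Q (n - a) j \<Longrightarrow> \<exists>t\<ge>1. t \<le> tm \<and> (n - a) * t \<le> 2 * card (hits f Q j t)"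
    using abundant_times_bounded[of Q f "n - a"] by blast
  define K where "K = nat \<lceil>v * tm / \<delta>\<rceil> + 1"
  have "v * tm / \<delta> \<le> K" unfolding K_def by linarith
  then have K: "v * tm \<le> \<delta> * K" "K > 0" using \<delta> by (simp_all add: field_simps K_def)
  let ?F = "graft f Q W P" and ?N = "K * (2 * Q) * P"
  have "a * ?N = (2 * a * P) * (K * Q)" by (simp add: algebra_simps)
  also have "\<dots> \<le> (v * card {r. r < P \<and> v \<le> W r}) * (K * Q)" using dens by (rule mult_le_mono1)
  also have "\<dots> = v * (K * (Q * card {r. r < P \<and> v \<le> W r}))" by simp
  also have "\<dots> \<le> v * card {x. x < ?N \<and> v \<le> ?F x}" by (intro mult_le_mono2 graft_density)
  finally have 1: "a * ?N \<le> v * card {x. x < ?N \<and> v \<le> ?F x}" .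
  have "real (\<Sum>x<?N. ?F x) = K * (P * real (\<Sum>j<Q. f j) + Q * real (\<Sum>r<P. W r))"
    unfolding sum_graft by simp
  also have "\<dots> \<le> K * (P * (E * Q) + Q * (D * P))"
    using f(1) sumW by (intro mult_left_mono add_mono) auto
  also have "\<dots> = (E + D) / 2 * ?N" by (simp add: field_simps)
  also have "\<dots> \<le> D' * ?N" using D' by (rule mult_right_mono) simp
  finally have 2: "real (\<Sum>x<?N. ?F x) \<le> D' * ?N" .
  have "real (card {x. x < ?N \<and> \<not> abundant ?F ?N n x}) \<le>
      real (K * P * card {j. j < Q \<and> \<not> abundant f Q (n - a) j} + K * Q * card {r. r < P \<and> \<not> abundant W P n r}
      + v * tm * (Q * P))"
    by (rule of_nat_mono, rule bad_graft[OF P Q(2) tm Q(3) dens])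
  also have "\<dots> = K * P * real (card {j. j < Q \<and> \<not> abundant f Q (n - a) j})
      + K * Q * real (card {r. r < P \<and> \<not> abundant W P n r}) + (real v * real tm) * (real Q * real P)"
    by simp
  also have "\<dots> \<le> K * P * (\<epsilon> * Q) + K * Q * ((\<epsilon> + \<delta>) * P) + (\<delta> * K) * (real Q * real P)"
    using f(2) badW K(1) by (intro add_mono mult_left_mono mult_right_mono) auto
  also have "\<dots> = (\<epsilon> + \<delta>) * ?N" by (simp add: algebra_simps)
  finally have 3: "real (card {x. x < ?N \<and> \<not> abundant ?F ?N n x}) \<le> (\<epsilon> + \<delta>) * ?N" .
  show ?thesis unfolding stage_def using 1 2 3 P Q(1) K(2) by (intro exI[of _ ?N] conjI exI[of _ ?F]) auto
qed

text \<open>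
  The gambler starts with capital \<open>1\<close> and doubles it in fair bets, at most \<open>L\<close> times. The capital
  before the ruin is \<open>2 ^ l\<close> with probability \<open>2 ^ - (l + 1)\<close> for \<open>l < L\<close>, and \<open>2 ^ L\<close> with probability
  \<open>2 ^ - L\<close>; its expectation is \<open>(L + 2) / 2\<close>. As the cost of the game is \<open>1\<close>, a unit of the target
  costs \<open>2 / (L + 2)\<close>. The target is overshot by less than \<open>2 ^ L\<close>, whence the additional \<open>2 ^ L\<close>.
\<close>

lemma achievable_bound:
  assumes L: "L \<ge> 1" and "n \<le> 2 ^ L"
  shows "achievable n (if n = 0 then 0 else 2 / (real L + 2) * (real n + 2 ^ L))"
  using assms(2)
proof (induction n rule: less_induct)
  case (less n)
  define e :: real where "e = 2 / (real L + 2)"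
  have e: "e > 0" by (simp add: e_def)
  define E where "E m = (if m = 0 then 0 else e * (real m + 2 ^ L))" for m :: nat
  show ?case
  proof (cases "n = 0")
    case True
    then show ?thesis using achievable_0 by simp
  next
    case False
    have ach: "achievable (n - 2 ^ l) (E (n - 2 ^ l))" for l
      unfolding E_def e_def using less.prems False by (intro less.IH) auto
    have E_le: "E (n - 2 ^ l) \<le> e * (real n - 2 ^ l + 2 ^ L)" if "l < L" for l
    proof -
      have "(2::real) ^ l \<le> 2 ^ L" using that by (intro power_increasing) auto
      then have "0 \<le> real n - 2 ^ l + 2 ^ L" using of_nat_0_le_iff[of n] by linarith
      then have "0 \<le> e * (real n - 2 ^ l + 2 ^ L)" using e by simp
      then show ?thesis by (simp add: E_def of_nat_diff)
    qed
    have "\<exists>N>0. \<exists>f. real (\<Sum>x<N. f x) \<le> E n * N \<and> real (card {x. x < N \<and> \<not> abundant f N n x}) \<le> \<epsilon> * N"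
      if \<epsilon>: "\<epsilon> > 0" for \<epsilon>
    proof -
      define R where "R l N f \<longleftrightarrow> N > 0 \<and> real (\<Sum>x<N. f x) \<le> E (n - 2 ^ l) * N \<and>
          real (card {x. x < N \<and> \<not> abundant f N (n - 2 ^ l) x}) \<le> \<epsilon> / 2 * N" for l N f
      have "\<exists>N f. R l N f" for l
        unfolding R_def using ach[of l, unfolded achievable_def, rule_format, of "\<epsilon> / 2"] \<epsilon> by simp
      then obtain Q f where "\<And>l. R l (Q l) (f l)" by metis
      then have Q: "\<And>l. Q l > 0"
        and f: "\<And>l. real (\<Sum>x<Q l. f l x) \<le> E (n - 2 ^ l) * Q l"
          "\<And>l. real (card {x. x < Q l \<and> \<not> abundant (f l) (Q l) (n - 2 ^ l) x}) \<le> \<epsilon> / 2 * Q l"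
        unfolding R_def by blast+
      define B where "B l = (\<Sum>x<Q l. f l x)" for l
      have B: "f l x \<le> B l" if "x < Q l" for l x
        unfolding B_def using that by (intro member_le_sum) auto
      define d where "d = (\<Sum>l<L. 4 * Q l * (2 + B l)) + 1"
      define v where "v = 2 ^ L * d"
      have v: "4 * Q l * (2 + B l) \<le> v" if "l < L" for l
      proof -
        have "4 * Q l * (2 + B l) \<le> (\<Sum>l<L. 4 * Q l * (2 + B l))"
          using that by (intro member_le_sum) auto
        also have "\<dots> \<le> d" by (simp add: d_def)
        also have "\<dots> \<le> v" by (simp add: v_def)
        finally show ?thesis .
      qed
      \<comment> \<open>The solution of \<open>D l = (e * (n - 2 ^ l + 2 ^ L) + D (l + 1)) / 2\<close> that equals \<open>E n\<close> at \<open>l = 0\<close>;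
        the value of \<open>e\<close> makes it large enough to pay for the spikes at \<open>l = L\<close>.\<close>
      define D where "D l = e * (real n + 2 ^ L + real l * 2 ^ l / 2)" for l :: nat
      have "stage n v (2 ^ l) (D l) (\<epsilon> / 2 + \<epsilon> / 2)" if "l \<le> L" for l
        using that
      proof (induction l rule: inc_induct)
        case base
        have "real (2 ^ L) = e * (2 ^ L + real L * 2 ^ L / 2)" by (simp add: e_def field_simps)
        also have "\<dots> \<le> D L" unfolding D_def using e by (intro mult_left_mono) auto
        finally have D: "real (2 ^ L) \<le> D L" .
        have "stage n v (2 ^ L) (real (2 ^ L)) \<epsilon>"
          unfolding v_def using L less.prems \<epsilon> self_le_power[of 2 L]
          by (intro stage_top) (auto simp: d_def)
        then show ?case using stage_mono[OF _ D] by simp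
      next
        case (step l)
        have D: "(E (n - 2 ^ l) + D (Suc l)) / 2 \<le> D l"
        proof -
          define X Y Z where "X = e * (real n + 2 ^ L)" and "Y = e * 2 ^ l" and "Z = e * (real l * 2 ^ l)"
          have "D (Suc l) = X + Y + Z" "D l = X + Z / 2"
            by (simp_all add: D_def X_def Y_def Z_def algebra_simps)
          moreover have "E (n - 2 ^ l) \<le> X - Y"
            using E_le[OF step.hyps(2)] by (simp add: X_def Y_def algebra_simps)
          ultimately show ?thesis by (simp add: field_simps)
        qed
        have W: "stage n v (2 * 2 ^ l) (D (Suc l)) (\<epsilon> / 2 + \<epsilon> / 2)"
          using step.IH by (simp only: power_Suc)
        have "\<epsilon> / 2 > 0" using \<epsilon> by simp
        with W Q B v[OF step.hyps(2)] f show ?case using D by (rule stage_step)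
      qed
      from this[of 0] have "stage n v 1 (E n) \<epsilon>" using False by (simp add: D_def E_def)
      then show ?thesis unfolding stage_def by blast
    qed
    then show ?thesis unfolding achievable_def using False by (simp add: E_def e_def)
  qed
qed

section \<open>Sequences defeated by an independent test system\<close>

text \<open>
  Finite subsets \<open>K\<close> of \<open>{k \<ge> 1. k < \<tau> * a k}\<close> take the place of this set, because it may be
  infinite, in which case its \<open>card\<close> would be \<open>0\<close>.
\<close>

definition unbounded_hits :: "(nat \<Rightarrow> real) \<Rightarrow> bool" where
  "unbounded_hits a \<longleftrightarrow> (\<forall>m::nat. \<exists>\<tau>\<ge>1. \<exists>K. finite K \<and> 0 \<notin> K \<and>
     real m * \<tau> \<le> card K \<and> (\<forall>k\<in>K. real k < \<tau> * a k))"

lemma convergent_averages_imp_small_terms: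
  fixes b :: "nat \<Rightarrow> real"
  assumes "convergent (\<lambda>n. (\<Sum>k=1..n. b k) / real n)"
  shows "\<exists>n0. \<forall>k\<ge>n0. b k \<le> real k"
proof -
  define A where "A = (\<lambda>n. (\<Sum>k=1..n. b k) / real n)"
  obtain L where L: "A \<longlonglongrightarrow> L"
    using assms unfolding A_def convergent_def by blast
  have "(\<lambda>n. A (Suc n) - A n * (real n / real (Suc n))) \<longlonglongrightarrow> L - L * 1"
    by (intro tendsto_intros L filterlim_compose[OF L filterlim_Suc] LIMSEQ_n_over_Suc_n)
  moreover have "A (Suc n) - A n * (real n / real (Suc n)) = b (Suc n) / real (Suc n)" for n
  proof -
    have "A n * (real n / real (Suc n)) = (\<Sum>k=1..n. b k) / real (Suc n)"
      by (cases "n = 0") (simp_all add: A_def)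
    then show ?thesis by (simp add: A_def add_divide_distrib)
  qed
  ultimately have "(\<lambda>n. b (Suc n) / real (Suc n)) \<longlonglongrightarrow> 0" by simp
  then have "eventually (\<lambda>n. b (Suc n) / real (Suc n) < 1) sequentially"
    by (rule order_tendstoD) simp
  then obtain n0 where n0: "\<And>n. n \<ge> n0 \<Longrightarrow> b (Suc n) / real (Suc n) < 1"
    by (auto simp: eventually_sequentially)
  have "b k \<le> real k" if "k \<ge> Suc n0" for k
    using n0[of "k - 1"] that by (cases k) (auto simp: field_simps)
  then show ?thesis by blast
qed

definition shift :: "(int \<Rightarrow> 'a) \<Rightarrow> int \<Rightarrow> 'a" where
  "shift y = (\<lambda>i. y (i + 1))"

lemma shift_funpow: "(shift ^^ n) y i = y (i + int n)"
  by (induction n arbitrary: y) (simp_all add: shift_def funpow_swap1 algebra_simps)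

lemma dynamical_system_shift:
  fixes D :: "'a measure"
  assumes D: "prob_space D" and [simp]: "space D = UNIV"
  shows "dynamical_system (PiM UNIV (\<lambda>_::int. D)) shift"
proof -
  define N where "N = PiM (UNIV :: int set) (\<lambda>_. D)"
  define shift' :: "(int \<Rightarrow> 'a) \<Rightarrow> int \<Rightarrow> 'a" where "shift' y = (\<lambda>i. y (i - 1))" for y
  have space_N: "space N = UNIV" by (simp add: N_def space_PiM)
  have SS: "shift (shift' z) = z" "shift' (shift z) = z" for z :: "int \<Rightarrow> 'a"
    by (auto simp: shift_def shift'_def)
  have bij: "bij (shift :: (int \<Rightarrow> 'a) \<Rightarrow> _)" by (rule o_bij[of shift']) (auto simp: SS)
  have inv: "inv shift = shift'" using SS by (intro inv_equality) auto
  have meas: "shift \<in> measurable N N" "shift' \<in> measurable N N"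
    unfolding N_def shift_def shift'_def by (rule measurable_PiM_single'; simp)+
  have "distr N N shift = N"
    using distr_PiM_reindex[of UNIV "\<lambda>_. D" "\<lambda>i::int. i + 1" UNIV] D
    by (simp add: N_def shift_def[abs_def] inj_def restrict_def)
  moreover have "prob_space N" unfolding N_def using D by (intro prob_space_PiM)
  ultimately show ?thesis
    unfolding N_def[symmetric] using bij inv meas
    by (simp add: dynamical_system_def dynamical_system_axioms_def space_N)
qed

text \<open>
  The law is a geometric mixture over \<open>j\<close> of the laws of \<open>\<tau> j\<close> times a Bernoulli variable with
  parameter \<open>1 / \<tau> j\<close>. Each component has mean \<open>1\<close>, hence so has the mixture.
\<close>

lemma heavy_pmf_exists:
  assumes \<tau>: "\<And>j. \<tau> j \<ge> (1 :: real)"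
  shows "\<exists>p :: real pmf. integrable (measure_pmf p) (\<lambda>x. x) \<and> (\<forall>j. (1 / 2) ^ Suc j / \<tau> j \<le> pmf p (\<tau> j))"
proof -
  define F where "F j = map_pmf (\<lambda>b. if b then \<tau> j else 0) (bernoulli_pmf (1 / \<tau> j))" for j
  define p where "p = bind_pmf (geometric_pmf (1 / 2)) F"
  have \<tau>': "0 < \<tau> j" "0 \<le> 1 / \<tau> j" "1 / \<tau> j \<le> 1" for j
    using \<tau>[of j] by (auto simp: field_simps intro: less_le_trans[of 0 1])
  have mean: "(\<integral>\<^sup>+x. ennreal (norm x) \<partial>F j) = 1" for j
  proof -
    have "(\<integral>\<^sup>+x. ennreal (norm x) \<partial>F j) = ennreal (\<tau> j) * ennreal (1 / \<tau> j)"
      using \<tau>'[of j] by (simp add: F_def)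
    also have "\<dots> = 1" using \<tau>'(1)[of j] by (simp add: ennreal_mult[symmetric])
    finally show ?thesis .
  qed
  have "integrable (measure_pmf p) (\<lambda>x. x)"
    by (rule integrableI_bounded) (simp_all add: p_def mean del: real_norm_def)
  moreover have "(1 / 2) ^ Suc j / \<tau> j \<le> pmf p (\<tau> j)" for j
  proof -
    have "1 / \<tau> j \<le> pmf (F j) (\<tau> j)"
    proof -
      have "1 / \<tau> j = measure (bernoulli_pmf (1 / \<tau> j)) {True}"
        using \<tau>'[of j] by (simp add: measure_pmf_single)
      also have "\<dots> \<le> measure (bernoulli_pmf (1 / \<tau> j)) ((\<lambda>b. if b then \<tau> j else 0) -` {\<tau> j})"
        by (intro measure_pmf.finite_measure_mono) auto
      finally show ?thesis by (simp add: F_def pmf_map)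
    qed
    then have "(1 / 2) ^ Suc j * (1 / \<tau> j) \<le> pmf (geometric_pmf (1 / 2)) j * pmf (F j) (\<tau> j)"
      by (intro mult_mono) (auto simp: \<tau>' less_imp_le)
    then have "ennreal ((1 / 2) ^ Suc j * (1 / \<tau> j)) \<le> ennreal (pmf (F j) (\<tau> j)) * emeasure (geometric_pmf (1 / 2)) {j}"
      by (simp add: emeasure_pmf_single ennreal_mult[symmetric] ennreal_leI mult.commute)
    also have "\<dots> = (\<integral>\<^sup>+i. ennreal (pmf (F j) (\<tau> j)) * indicator {j} i \<partial>geometric_pmf (1 / 2))"
      by (simp add: nn_integral_cmult_indicator)
    also have "\<dots> \<le> (\<integral>\<^sup>+i. ennreal (pmf (F i) (\<tau> j)) \<partial>geometric_pmf (1 / 2))"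
      by (intro nn_integral_mono) (auto simp: indicator_def)
    also have "\<dots> = ennreal (pmf p (\<tau> j))" unfolding p_def by (rule ennreal_pmf_bind[symmetric])
    finally show ?thesis by simp
  qed
  ultimately show ?thesis by blast
qed

lemma prob_iid_avoids:
  fixes p :: "'a pmf"
  assumes "finite J"
  shows "measure (PiM UNIV (\<lambda>_::'i. measure_pmf p)) {y. \<forall>i\<in>J. y i \<noteq> c} = (1 - pmf p c) ^ card J"
proof -
  interpret product_prob_space "\<lambda>_::'i. measure_pmf p" UNIV ..
  have *: "{y. \<forall>i\<in>J. y i \<noteq> c} = prod_emb UNIV (\<lambda>_. measure_pmf p) J (Pi\<^sub>E J (\<lambda>_. - {c}))"
    by (auto simp: prod_emb_def space_PiM PiE_def)
  have "measure (measure_pmf p) (- {c}) = 1 - pmf p c"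
    using measure_pmf.prob_compl[of "{c}" p] by (simp add: measure_pmf_single Compl_eq_Diff_UNIV)
  then show ?thesis unfolding * using assms by (subst measure_PiM_emb) auto
qed

text \<open>
  The test system is an i.i.d. sequence with the heavy-tailed law above, for \<open>\<tau> j\<close> with at least
  \<open>4 ^ (j + 1) * \<tau> j\<close> hits. The number of hits outweighs the probability of the value \<open>\<tau> j\<close>,
  so almost surely \<open>a k * g (S ^ k y) > k\<close> for infinitely many \<open>k\<close>, while the terms of a
  sequence with convergent averages are \<open>o(k)\<close>.
\<close>

lemma unbounded_hits_not_good_universal:
  assumes "unbounded_hits a"
  shows "\<not> good_universal_L1 TYPE(int \<Rightarrow> real) a"
proof
  assume gu: "good_universal_L1 TYPE(int \<Rightarrow> real) a"
  define R where "R j \<tau> K \<longleftrightarrow> \<tau> \<ge> 1 \<and> finite K \<and> 0 \<notin> K \<and> 4 ^ Suc j * \<tau> \<le> real (card K) \<and>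
      (\<forall>k\<in>K. real k < \<tau> * a k)" for j :: nat and \<tau> :: real and K
  have "\<exists>\<tau> K. R j \<tau> K" for j
    using assms[unfolded unbounded_hits_def, rule_format, of "4 ^ Suc j"] unfolding R_def by auto
  then obtain \<tau> K where R: "\<And>j. R j (\<tau> j) (K j)" by metis
  have \<tau>: "\<tau> j \<ge> 1" and K: "finite (K j)" "4 ^ Suc j * \<tau> j \<le> real (card (K j))" for j
    using R[of j] unfolding R_def by blast+
  have hit: "real k < \<tau> j * a k" if "k \<in> K j" for j k
    using R[of j] that unfolding R_def by blast
  from heavy_pmf_exists[of \<tau>, OF \<tau>] obtain p where p: "integrable (measure_pmf p) (\<lambda>x. x)"
      "\<forall>j. (1 / 2) ^ Suc j / \<tau> j \<le> pmf p (\<tau> j)"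
    by (elim exE conjE)
  define N where "N = PiM (UNIV :: int set) (\<lambda>_. measure_pmf p)"
  interpret product_prob_space "\<lambda>_::int. measure_pmf p" UNIV ..
  interpret N: prob_space N unfolding N_def by (rule P.prob_space_axioms)
  have comp: "(\<lambda>y. y i) \<in> measurable N (count_space UNIV)" for i
  proof -
    have "(\<lambda>y. y i) \<in> measurable N (measure_pmf p)"
      unfolding N_def by (rule measurable_component_singleton) simp
    then show ?thesis using measurable_cong_sets[OF refl sets_measure_pmf_count_space] by blast
  qed
  have sys: "dynamical_system N shift"
    unfolding N_def by (rule dynamical_system_shift) (auto intro: measure_pmf.prob_space_axioms)
  have int0: "integrable N (\<lambda>y. y 0)"
  proof -
    have "integrable (distr N (measure_pmf p) (\<lambda>y. y 0)) (\<lambda>x. x)"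
      unfolding N_def using p(1) by (subst PiM_component) auto
    then show ?thesis unfolding N_def by (subst (asm) integrable_distr_eq) auto
  qed
  have "AE y in N. convergent (\<lambda>n. (\<Sum>k=1..n. a k * y (int k)) / real n)"
    using gu[unfolded good_universal_L1_def, rule_format, OF sys int0] by (simp add: shift_funpow)
  then have conv: "AE y in N. \<exists>n0. \<forall>k\<ge>n0. a k * y (int k) \<le> real k"
    by eventually_elim (rule convergent_averages_imp_small_terms)
  define A where "A n0 = {y \<in> space N. \<forall>k\<ge>n0. a k * y (int k) \<le> real k}" for n0
  have A_sets: "A n0 \<in> sets N" for n0
  proof -
    have [measurable]: "(\<lambda>y. y (int k)) \<in> borel_measurable N" for k
      using measurable_comp[OF comp[of "int k"], of "\<lambda>x::real. x" borel] by (simp add: comp_def)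
    show ?thesis unfolding A_def by measurable
  qed
  have le: "measure N (A n0) \<le> exp (real n0) * (1 / 2) ^ j" for n0 j
  proof -
    define q where "q = (1 / 2) ^ Suc j / \<tau> j"
    define J where "J = int ` (K j - {..<n0})"
    have q_le: "q \<le> pmf p (\<tau> j)" unfolding q_def by (rule p(2)[rule_format])
    have \<tau>_pos: "0 < \<tau> j" using \<tau>[of j] by linarith
    then have q: "0 \<le> q" by (simp add: q_def)
    have q1: "q \<le> 1" using q_le pmf_le_1[of p "\<tau> j"] by linarith
    have fin: "finite J" using K(1) by (simp add: J_def)
    have "card J = card (K j - {..<n0})" unfolding J_def by (rule card_image) simp
    moreover have "card (K j) \<le> card ((K j - {..<n0}) \<union> {..<n0})"
      using K(1)[of j] by (intro card_mono) auto
    moreover have "\<dots> \<le> card (K j - {..<n0}) + n0"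
      using card_Un_le[of "K j - {..<n0}" "{..<n0}"] by simp
    ultimately have "card (K j) \<le> card J + n0" by linarith
    then have "real (card (K j)) \<le> real (card J) + real n0" by linarith
    then have "4 ^ Suc j * \<tau> j \<le> real (card J) + real n0"
      using K(2)[of j] by linarith
    then have "q * (4 ^ Suc j * \<tau> j) \<le> q * (real (card J) + real n0)"
      using q by (rule mult_left_mono)
    moreover have "q * (4 ^ Suc j * \<tau> j) = 2 ^ Suc j"
    proof -
      have nonzero: "x / t * (y * t) = x * y" if "t \<noteq> 0" for x y t :: real using that by simp
      have "q * (4 ^ Suc j * \<tau> j) = (1 / 2) ^ Suc j * 4 ^ Suc j"
        unfolding q_def using \<tau>_pos by (intro nonzero) linarith
      also have "\<dots> = 2 ^ Suc j" unfolding power_mult_distrib[symmetric] by simp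
      finally show ?thesis .
    qed
    moreover have "q * real n0 \<le> real n0" using mult_right_mono[OF q1, of "real n0"] by simp
    moreover have "(2::real) ^ j \<le> 2 ^ Suc j" by simp
    ultimately have big: "2 ^ j - real n0 \<le> q * card J" unfolding distrib_left by linarith
    have "A n0 \<subseteq> {y. \<forall>i\<in>J. y i \<noteq> \<tau> j}"
    proof (intro subsetI CollectI ballI notI)
      fix y i assume y: "y \<in> A n0" "i \<in> J" "y i = \<tau> j"
      then obtain k where k: "k \<in> K j" "n0 \<le> k" "i = int k" by (fastforce simp: J_def not_less)
      then have "a k * \<tau> j \<le> real k" using y by (auto simp: A_def)
      with hit[OF k(1)] show False by (simp add: mult.commute)
    qed
    moreover have "{y. \<forall>i\<in>J. y i \<noteq> \<tau> j} \<in> sets N"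
    proof -
      have "{y \<in> space N. y i \<noteq> \<tau> j} = (\<lambda>y. y i) -` (- {\<tau> j}) \<inter> space N" for i by auto
      then have "{y \<in> space N. y i \<noteq> \<tau> j} \<in> sets N" for i
        using measurable_sets[OF comp[of i], of "- {\<tau> j}"] by simp
      then have "{y \<in> space N. \<forall>i\<in>J. y i \<noteq> \<tau> j} \<in> sets N"
        using fin by (rule sets.sets_Collect_finite_All)
      then show ?thesis by (simp add: N_def space_PiM)
    qed
    ultimately have "measure N (A n0) \<le> measure N {y. \<forall>i\<in>J. y i \<noteq> \<tau> j}"
      by (rule N.finite_measure_mono)
    also have "\<dots> = (1 - pmf p (\<tau> j)) ^ card J" unfolding N_def by (rule prob_iid_avoids[OF fin])
    also have "\<dots> \<le> exp (- q) ^ card J"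
      using q_le pmf_le_1[of p "\<tau> j"] exp_ge_add_one_self[of "- q"] by (intro power_mono) auto
    also have "\<dots> = exp (- (q * card J))" by (simp add: exp_of_nat_mult[symmetric] mult.commute)
    also have "\<dots> \<le> exp (real n0 - 2 ^ j)" using big by simp
    also have "\<dots> = exp (real n0) * (1 / exp (2 ^ j))" by (simp add: exp_diff)
    also have "\<dots> \<le> exp (real n0) * (1 / 2 ^ j)"
    proof -
      have "(2 :: real) ^ j \<le> exp (2 ^ j)" using exp_ge_add_one_self[of "2 ^ j"] by linarith
      then show ?thesis by (intro mult_left_mono divide_left_mono) auto
    qed
    also have "\<dots> = exp (real n0) * (1 / 2) ^ j" by (simp add: power_one_over)
    finally show ?thesis .
  qed
  have "AE y in N. y \<notin> A n0" for n0
  proof -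
    have "(\<lambda>j. exp (real n0) * (1 / 2) ^ j) \<longlonglongrightarrow> exp (real n0) * 0"
      by (intro tendsto_mult tendsto_const LIMSEQ_realpow_zero) auto
    then have "measure N (A n0) \<le> exp (real n0) * 0"
      by (rule LIMSEQ_le_const) (use le in blast)
    then have "A n0 \<in> null_sets N"
      using A_sets by (auto simp: null_sets_def N.emeasure_eq_measure measure_le_0_iff)
    then show ?thesis by (rule AE_not_in)
  qed
  then have "AE y in N. \<forall>n0. y \<notin> A n0" by (simp add: AE_all_countable)
  with conv AE_space have "AE y in N. False" by eventually_elim (auto simp: A_def)
  then show False by simp
qed

section \<open>A product of rotations with unboundedly many hits\<close>

text \<open>
  Fixing the numbers from \<open>N\<close> on, which carry no mass, makes the rotation of \<open>{..<N}\<close> a bijection of the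
  whole type.
\<close>

definition rot :: "nat \<Rightarrow> nat \<Rightarrow> nat" where
  "rot N x = (if x < N then Suc x mod N else x)"

lemma bij_rot: "bij (rot N)"
proof -
  have "inj_on (rot N) {..<N}"
    by (rule inj_onI) (auto simp: rot_def mod_Suc split: if_splits)
  moreover have "rot N ` {..<N} \<subseteq> {..<N}" by (auto simp: rot_def)
  ultimately have "bij_betw (rot N) {..<N} {..<N}"
    by (simp add: bij_betw_def endo_inj_surj)
  moreover have "bij_betw (rot N) (- {..<N}) (- {..<N})"
    by (rule bij_betw_cong[THEN iffD2, OF _ bij_betw_id]) (auto simp: rot_def)
  ultimately have "bij_betw (rot N) ({..<N} \<union> - {..<N}) ({..<N} \<union> - {..<N})"
    by (rule bij_betw_combine) auto
  then show ?thesis by (simp only: Compl_partition)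
qed

lemma rot_funpow: "x + k < N \<Longrightarrow> (rot N ^^ k) x = x + k"
  by (induction k) (auto simp: rot_def)

lemma map_pmf_rot:
  assumes "N > 0"
  shows "map_pmf (rot N) (pmf_of_set {..<N}) = pmf_of_set {..<N}"
proof -
  have "rot N ` {..<N} \<subseteq> {..<N}" by (auto simp: rot_def)
  moreover have inj: "inj_on (rot N) {..<N}" using bij_rot by (blast intro: inj_on_subset bij_is_inj)
  ultimately have "rot N ` {..<N} = {..<N}" by (simp add: endo_inj_surj)
  then show ?thesis using assms inj by (subst map_pmf_of_set_inj) (auto simp: lessThan_empty_iff)
qed

lemma dynamical_system_product:
  fixes p :: "'i \<Rightarrow> 'a pmf"
  assumes bij: "\<And>i. bij (R i)" and inv: "\<And>i. map_pmf (R i) (p i) = p i"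
  shows "dynamical_system (PiM UNIV (\<lambda>i. measure_pmf (p i))) (\<lambda>x i. R i (x i))"
proof -
  define M where "M = PiM UNIV (\<lambda>i. measure_pmf (p i))"
  define T where "T = (\<lambda>(x :: 'i \<Rightarrow> 'a) i. R i (x i))"
  define T' where "T' = (\<lambda>(x :: 'i \<Rightarrow> 'a) i. inv (R i) (x i))"
  interpret product_prob_space "\<lambda>i. measure_pmf (p i)" UNIV ..
  have meas: "(\<lambda>x i. G i (x i)) \<in> measurable M M" for G :: "'i \<Rightarrow> 'a \<Rightarrow> 'a"
    unfolding M_def
  proof (rule measurable_PiM_single')
    fix i
    have "(\<lambda>x. x i) \<in> measurable (PiM UNIV (\<lambda>i. measure_pmf (p i))) (measure_pmf (p i))"
      by (rule measurable_component_singleton) simp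
    moreover have "G i \<in> measurable (measure_pmf (p i)) (measure_pmf (p i))" by simp
    ultimately show "(\<lambda>x. G i (x i)) \<in> measurable (PiM UNIV (\<lambda>i. measure_pmf (p i))) (measure_pmf (p i))"
      by (rule measurable_compose)
  qed simp
  have space_M: "space M = UNIV" by (simp add: M_def space_PiM)
  have TT: "T (T' z) = z" "T' (T z) = z" for z
    using bij by (auto simp: T_def T'_def bij_def surj_f_inv_f)
  have "bij T" by (rule o_bij[of T']) (auto simp: TT)
  moreover have "inv T = T'" using TT by (intro inv_equality) auto
  moreover have "distr M M T = M"
    unfolding M_def
  proof (rule PiM_eq)
    fix J :: "'i set" and F :: "'i \<Rightarrow> 'a set"
    assume J: "finite J"
    have T: "T \<in> measurable (PiM UNIV (\<lambda>i. measure_pmf (p i))) (PiM UNIV (\<lambda>i. measure_pmf (p i)))"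
      using meas unfolding M_def T_def .
    have pre: "T -` prod_emb UNIV (\<lambda>i. measure_pmf (p i)) J (Pi\<^sub>E J F) \<inter> space (PiM UNIV (\<lambda>i. measure_pmf (p i)))
        = prod_emb UNIV (\<lambda>i. measure_pmf (p i)) J (Pi\<^sub>E J (\<lambda>i. R i -` F i))"
      by (auto simp: prod_emb_def space_PiM T_def PiE_iff)
    have "emeasure (distr (PiM UNIV (\<lambda>i. measure_pmf (p i))) (PiM UNIV (\<lambda>i. measure_pmf (p i))) T)
        (prod_emb UNIV (\<lambda>i. measure_pmf (p i)) J (Pi\<^sub>E J F)) = (\<Prod>j\<in>J. emeasure (measure_pmf (p j)) (R j -` F j))"
      using J by (subst emeasure_distr[OF T], intro sets_PiM_I) (auto simp: pre emeasure_PiM_emb)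
    also have "\<dots> = (\<Prod>j\<in>J. emeasure (measure_pmf (p j)) (F j))"
    proof (rule prod.cong[OF refl])
      fix j
      have "emeasure (measure_pmf (p j)) (F j) = emeasure (measure_pmf (map_pmf (R j) (p j))) (F j)"
        by (simp only: inv)
      then show "emeasure (measure_pmf (p j)) (R j -` F j) = emeasure (measure_pmf (p j)) (F j)"
        by simp
    qed
    finally show "emeasure (distr (PiM UNIV (\<lambda>i. measure_pmf (p i))) (PiM UNIV (\<lambda>i. measure_pmf (p i))) T)
        (prod_emb UNIV (\<lambda>i. measure_pmf (p i)) J (Pi\<^sub>E J F)) = (\<Prod>j\<in>J. emeasure (measure_pmf (p j)) (F j))" .
  qed simp
  moreover have "prob_space M" unfolding M_def by (rule P.prob_space_axioms)
  ultimately show ?thesis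
    unfolding M_def[symmetric] T_def[symmetric]
    using meas by (simp add: dynamical_system_def dynamical_system_axioms_def space_M T_def T'_def)
qed

lemma funpow_product: "((\<lambda>x i. R i (x i)) ^^ k) x i = (R i ^^ k) (x i)"
  for R :: "'i \<Rightarrow> 'a \<Rightarrow> 'a"
  by (induction k) auto

lemma AE_summable_of_summable_integrals:
  fixes f :: "nat \<Rightarrow> 'a \<Rightarrow> real"
  assumes int: "\<And>n. integrable M (f n)" and nonneg: "\<And>n x. 0 \<le> f n x"
    and sum: "summable (\<lambda>n. integral\<^sup>L M (f n))"
  shows "AE x in M. summable (\<lambda>n. f n x)"
proof -
  have [measurable]: "f n \<in> borel_measurable M" for n using int by auto
  have "(\<integral>\<^sup>+x. (\<Sum>n. ennreal (f n x)) \<partial>M) = (\<Sum>n. \<integral>\<^sup>+x. ennreal (f n x) \<partial>M)"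
    by (rule nn_integral_suminf) simp
  also have "\<dots> = (\<Sum>n. ennreal (integral\<^sup>L M (f n)))"
    using int nonneg by (intro suminf_cong nn_integral_eq_integral) auto
  also have "\<dots> = ennreal (\<Sum>n. integral\<^sup>L M (f n))"
    using sum nonneg by (intro suminf_ennreal2) auto
  finally have "(\<integral>\<^sup>+x. (\<Sum>n. ennreal (f n x)) \<partial>M) \<noteq> \<infinity>" by simp
  then have "AE x in M. (\<Sum>n. ennreal (f n x)) \<noteq> \<infinity>"
    by (intro nn_integral_PInf_AE) auto
  then show ?thesis by eventually_elim (rule summable_suminf_not_top, auto simp: nonneg)
qed

lemma AE_funpow:
  assumes "dynamical_system M T" "AE x in M. P x"
  shows "AE x in M. \<forall>k. P ((T ^^ k) x)"
proof -
  interpret dynamical_system M T by fact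
  have "AE x in M. P ((T ^^ k) x)" for k
  proof (induction k)
    case (Suc k)
    then have "AE x in distr M M T. P ((T ^^ k) x)" unfolding distr_T .
    from AE_distrD[OF measurable_T this] show ?case by (simp add: funpow_swap1)
  qed (use assms(2) in simp)
  then show ?thesis by (simp add: AE_all_countable)
qed

text \<open>
  After scaling by \<open>c\<close> the mean is at most \<open>2 ^ - m\<close>, while the guaranteed ratio of hits to time is
  at least \<open>m\<close>. The choice of \<open>L\<close> makes \<open>c * 2 ^ L\<close>, of order \<open>2 ^ - m * L\<close>, exceed \<open>2 * m\<close>.
\<close>

lemma abundant_blocks_exist:
  "\<exists>N f c n. N > 0 \<and> 0 < c \<and> c \<le> 1 \<and> c * real (\<Sum>x<N. f x) \<le> (1 / 2) ^ m * real N \<and>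
     2 * real m \<le> c * real n \<and> real (card {x. x < N \<and> \<not> abundant f N n x}) \<le> (1 / 2) ^ m * N"
proof -
  define L where "L = 8 * m * 2 ^ m + 1"
  define c :: real where "c = (1 / 2) ^ m * (real L + 2) / (4 * 2 ^ L)"
  have "achievable (2 ^ L) (2 / (real L + 2) * (real (2 ^ L) + 2 ^ L))"
    using achievable_bound[of L "2 ^ L"] by (simp add: L_def)
  then have "\<exists>N>0. \<exists>f. real (\<Sum>x<N. f x) \<le> (2 / (real L + 2) * (real (2 ^ L) + 2 ^ L)) * N \<and>
      real (card {x. x < N \<and> \<not> abundant f N (2 ^ L) x}) \<le> (1 / 2) ^ m * N"
    unfolding achievable_def by (rule allE[of _ "(1 / 2) ^ m"]) simp
  then obtain N f where N: "N > 0"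
    and f: "real (\<Sum>x<N. f x) \<le> (2 / (real L + 2) * (real (2 ^ L) + 2 ^ L)) * N"
    and bad: "real (card {x. x < N \<and> \<not> abundant f N (2 ^ L) x}) \<le> (1 / 2) ^ m * N"
    by blast
  have c: "c > 0" by (simp add: c_def)
  have "(1 / 2) ^ m * (real L + 2) \<le> 1 * (real L + 2)" by (intro mult_right_mono power_le_one) auto
  also have "\<dots> \<le> 4 * 2 ^ L"
  proof -
    have "real L < 2 ^ L" "(1 :: real) \<le> 2 ^ L" by simp_all
    then show ?thesis unfolding mult_1 by linarith
  qed
  finally have c1: "c \<le> 1" by (simp add: c_def)
  have "c * real (\<Sum>x<N. f x) \<le> c * ((2 / (real L + 2) * (real (2 ^ L) + 2 ^ L)) * N)"
    using f c by (intro mult_left_mono) auto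
  also have "\<dots> = (1 / 2) ^ m * real N"
    by (simp add: c_def)
  finally have mean: "c * real (\<Sum>x<N. f x) \<le> (1 / 2) ^ m * real N" .
  have "c * real (2 ^ L) = (1 / 2) ^ m * (8 * real m * 2 ^ m + 3) / 4"
    by (simp add: c_def L_def)
  also have "\<dots> = 2 * real m + 3 * (1 / 2) ^ m / 4" by (simp add: field_simps power_one_over)
  finally have big: "2 * real m \<le> c * real (2 ^ L)" by simp
  show ?thesis
    by (rule exI[of _ N], rule exI[of _ f], rule exI[of _ c], rule exI[of _ "2 ^ L"])
      (intro conjI N c c1 mean big bad)
qed

text \<open>
  If \<open>a\<close> dominates the word \<open>f m\<close> scaled by \<open>c m\<close> and read from position \<open>x m\<close>, then the hits at
  time \<open>t\<close> become hits at time \<open>t / c m\<close>.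
\<close>

lemma unbounded_hits_of_abundant_blocks:
  fixes N :: "nat \<Rightarrow> nat" and a :: "nat \<Rightarrow> real"
  assumes c: "\<And>m. 0 < c m" "\<And>m. c m \<le> 1"
    and n: "\<And>m. 2 * real m \<le> c m * real (n m)"
    and good: "eventually (\<lambda>m. abundant (f m) (N m) (n m) (x m)) sequentially"
    and a: "\<And>m k. x m + k < N m \<Longrightarrow> c m * real (f m (x m + k)) \<le> a k"
  shows "unbounded_hits a"
  unfolding unbounded_hits_def
proof
  fix m0 :: nat
  obtain m where m: "m \<ge> m0" "abundant (f m) (N m) (n m) (x m)"
    using good unfolding eventually_sequentially by (metis nat_le_linear)
  then obtain t where t: "t \<ge> 1" "n m * t \<le> 2 * card (hits (f m) (N m) (x m) t)"
    by (auto simp: abundant_def)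
  define \<tau> where "\<tau> = real t / c m"
  have "1 \<le> \<tau>" using t(1) c[of m] by (simp add: \<tau>_def)
  moreover have "real m0 * \<tau> \<le> card (hits (f m) (N m) (x m) t)"
  proof -
    have "2 * (real m0 * \<tau>) \<le> 2 * real m * \<tau>" using m(1) \<open>1 \<le> \<tau>\<close> by simp
    also have "\<dots> \<le> c m * real (n m) * \<tau>" using n[of m] \<open>1 \<le> \<tau>\<close> by (intro mult_right_mono) auto
    also have "\<dots> = real (n m * t)" using c(1)[of m] by (simp add: \<tau>_def)
    also have "\<dots> \<le> real (2 * card (hits (f m) (N m) (x m) t))" using t(2) by (rule of_nat_mono)
    finally show ?thesis by simp
  qed
  moreover have "real k < \<tau> * a k" if k: "k \<in> hits (f m) (N m) (x m) t" for k
  proof -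
    have "k + 1 \<le> t * f m (x m + k)" using k by (simp add: hits_def)
    then have "real k < real t * real (f m (x m + k))"
      using of_nat_mono[of "k + 1" "t * f m (x m + k)", where 'a = real] by simp
    also have "\<dots> = \<tau> * (c m * real (f m (x m + k)))" using c(1)[of m] by (simp add: \<tau>_def)
    also have "\<dots> \<le> \<tau> * a k" using a[of m k] k \<open>1 \<le> \<tau>\<close> by (intro mult_left_mono) (auto simp: hits_def)
    finally show ?thesis .
  qed
  moreover have "0 \<notin> hits (f m) (N m) (x m) t" by (simp add: hits_def)
  ultimately show "\<exists>\<tau>\<ge>1. \<exists>K. finite K \<and> 0 \<notin> K \<and> real m0 * \<tau> \<le> card K \<and> (\<forall>k\<in>K. real k < \<tau> * a k)"
    using finite_hits
    by (intro exI[of _ \<tau>] exI[of _ "hits (f m) (N m) (x m) t"] conjI) auto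
qed

text \<open>
  All words run simultaneously in the product of the rotations of \<open>{..<N m}\<close>, and \<open>h\<close> adds up their
  scaled values. The means are summable, so \<open>h\<close> is integrable; the proportions of bad positions are
  summable, so by Borel and Cantelli almost every point is at a good position in all but finitely many words.
\<close>

lemma system_with_unbounded_hits:
  "\<exists>(M :: (nat \<Rightarrow> nat) measure) T h. dynamical_system M T \<and> integrable M (h :: _ \<Rightarrow> real) \<and>
     (AE x in M. unbounded_hits (\<lambda>k. h ((T ^^ k) x)))"
proof -
  define B where "B m N f c n \<longleftrightarrow> N > 0 \<and> 0 < c \<and> c \<le> 1 \<and> c * real (\<Sum>x<N. f x) \<le> (1 / 2) ^ m * real N \<and>
     2 * real m \<le> c * real n \<and> real (card {x. x < N \<and> \<not> abundant f N n x}) \<le> (1 / 2) ^ m * N"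
    for m N n :: nat and f and c :: real
  have "\<exists>N f c n. B m N f c n" for m unfolding B_def by (rule abundant_blocks_exist)
  then obtain N f c n where B: "\<And>m. B m (N m) (f m) (c m) (n m)" by metis
  have N: "N m > 0" and c: "0 < c m" "c m \<le> 1"
    and mean: "c m * real (\<Sum>x<N m. f m x) \<le> (1 / 2) ^ m * real (N m)"
    and n: "2 * real m \<le> c m * real (n m)"
    and bad: "real (card {x. x < N m \<and> \<not> abundant (f m) (N m) (n m) x}) \<le> (1 / 2) ^ m * N m" for m
    using B[of m, unfolded B_def] by - (elim conjE, assumption)+
  define p where "p m = pmf_of_set {..<N m}" for m
  define M where "M = PiM UNIV (\<lambda>m. measure_pmf (p m))"
  define T where "T = (\<lambda>x m. rot (N m) (x m))"
  define g where "g m x = c m * real (f m (x m))" for m and x :: "nat \<Rightarrow> nat"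
  interpret product_prob_space "\<lambda>m. measure_pmf (p m)" UNIV ..
  have sys: "dynamical_system M T"
    unfolding M_def T_def by (intro dynamical_system_product bij_rot) (simp add: p_def map_pmf_rot N)
  then interpret dynamical_system M T .
  have set_p: "set_pmf (p m) = {..<N m}" for m using N[of m] by (simp add: p_def lessThan_empty_iff)
  have comp: "(\<lambda>x. x m) \<in> measurable M (measure_pmf (p m))" for m
    unfolding M_def by (rule measurable_component_singleton) simp
  have distr: "distr M (measure_pmf (p m)) (\<lambda>x. x m) = measure_pmf (p m)" for m
    unfolding M_def by (rule PiM_component) simp
  have int_g: "integrable M (g m)" and mean_g: "integral\<^sup>L M (g m) \<le> (1 / 2) ^ m" for m
  proof -
    have "integrable (distr M (measure_pmf (p m)) (\<lambda>x. x m)) (\<lambda>x. c m * real (f m x))"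
      unfolding distr by (rule integrable_measure_pmf_finite) (simp add: set_p)
    then show "integrable M (g m)"
      unfolding g_def by (subst (asm) integrable_distr_eq[OF comp]) auto
    have "integral\<^sup>L M (g m) = integral\<^sup>L (distr M (measure_pmf (p m)) (\<lambda>x. x m)) (\<lambda>x. c m * real (f m x))"
      unfolding g_def by (subst integral_distr[OF comp]) auto
    also have "\<dots> = c m * real (\<Sum>x<N m. f m x) / real (N m)"
      unfolding distr unfolding p_def using N[of m]
      by (subst integral_pmf_of_set) (auto simp: sum_distrib_left lessThan_empty_iff)
    also have "\<dots> \<le> (1 / 2) ^ m" using mean[of m] N[of m] by (simp add: divide_le_eq)
    finally show "integral\<^sup>L M (g m) \<le> (1 / 2) ^ m" .
  qed
  have g_nonneg: "0 \<le> g m x" for m x using c(1)[of m] by (simp add: g_def)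
  have sum_g: "summable (\<lambda>m. integral\<^sup>L M (g m))"
    by (rule summable_comparison_test'[OF summable_geometric[of "1 / 2 :: real"], of 0])
      (use mean_g g_nonneg in \<open>auto simp: integral_nonneg\<close>)
  have summ: "AE x in M. summable (\<lambda>m. g m x)"
    using int_g g_nonneg sum_g by (rule AE_summable_of_summable_integrals)
  define h where "h x = (\<Sum>m. g m x)" for x
  have int_h: "integrable M h"
    unfolding h_def using int_g summ sum_g by (intro integrable_suminf) (auto simp: g_nonneg)
  define Bad where "Bad m = {x. \<not> abundant (f m) (N m) (n m) x}" for m
  have Bad_sets: "(\<lambda>x. x m) -` Bad m \<inter> space M \<in> sets M" for m
    by (rule measurable_sets[OF comp]) simp
  have "measure M ((\<lambda>x. x m) -` Bad m \<inter> space M) \<le> (1 / 2) ^ m" for m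
  proof -
    have "measure M ((\<lambda>x. x m) -` Bad m \<inter> space M) = measure (distr M (measure_pmf (p m)) (\<lambda>x. x m)) (Bad m)"
      by (rule measure_distr[symmetric, OF comp]) simp
    also have "\<dots> = measure (measure_pmf (p m)) (Bad m)" unfolding distr ..
    also have "\<dots> = real (card ({..<N m} \<inter> Bad m)) / real (N m)"
      unfolding p_def using N[of m] by (subst measure_pmf_of_set) (auto simp: lessThan_empty_iff)
    also have "{..<N m} \<inter> Bad m = {x. x < N m \<and> \<not> abundant (f m) (N m) (n m) x}" by (auto simp: Bad_def)
    finally show ?thesis using bad[of m] N[of m] by (simp add: divide_le_eq)
  qed
  then have "AE x in M. eventually (\<lambda>m. x \<in> space M - ((\<lambda>x. x m) -` Bad m \<inter> space M)) sequentially"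
    using Bad_sets
    by (intro borel_cantelli_AE1 summable_comparison_test'[OF summable_geometric[of "1 / 2 :: real"], of 0])
      (auto simp: emeasure_eq_measure)
  moreover have "AE x in M. \<forall>k. summable (\<lambda>m. g m ((T ^^ k) x))"
    using sys summ by (rule AE_funpow)
  ultimately have "AE x in M. unbounded_hits (\<lambda>k. h ((T ^^ k) x))"
  proof eventually_elim
    case (elim x)
    have "eventually (\<lambda>m. abundant (f m) (N m) (n m) (x m)) sequentially"
      using elim(1) by eventually_elim (auto simp: Bad_def)
    moreover have "c m * real (f m (x m + k)) \<le> h ((T ^^ k) x)" if "x m + k < N m" for m k
    proof -
      have "c m * real (f m (x m + k)) = g m ((T ^^ k) x)"
        using that by (simp add: g_def T_def funpow_product[where R = "\<lambda>m. rot (N m)"] rot_funpow)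
      also have "\<dots> \<le> h ((T ^^ k) x)"
        unfolding h_def using sum_le_suminf[of "\<lambda>m. g m ((T ^^ k) x)" "{m}"] elim(2) g_nonneg by auto
      finally show ?thesis .
    qed
    ultimately show ?case using c n by (intro unbounded_hits_of_abundant_blocks[of c n f N x])
  qed
  with sys int_h show ?thesis by blast
qed

section \<open>Failure of the return times theorem for pairs of integrable functions\<close>

theorem theorem3:
  "\<exists>(M :: (int \<Rightarrow> real) measure) (T :: (int \<Rightarrow> real) \<Rightarrow> int \<Rightarrow> real) (f :: (int \<Rightarrow> real) \<Rightarrow> real).
     dynamical_system M T \<and> integrable M f \<and>
     \<not> (AE x in M. good_universal_L1 TYPE(int \<Rightarrow> real) (\<lambda>n. f ((T ^^ n) x)))"
proof -
  obtain M :: "(nat \<Rightarrow> nat) measure" and T and h :: "(nat \<Rightarrow> nat) \<Rightarrow> real"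
    where M: "dynamical_system M T" "integrable M h"
      and hits: "AE x in M. unbounded_hits (\<lambda>k. h ((T ^^ k) x))"
    using system_with_unbounded_hits by blast
  interpret dynamical_system M T by fact
  have "\<not> (AE x in M. good_universal_L1 TYPE(int \<Rightarrow> real) (\<lambda>n. h ((T ^^ n) x)))"
  proof
    assume "AE x in M. good_universal_L1 TYPE(int \<Rightarrow> real) (\<lambda>n. h ((T ^^ n) x))"
    with hits have "AE x in M. False"
      by eventually_elim (use unbounded_hits_not_good_universal in blast)
    then show False by simp
  qed
  from return_times_failure_transfer[OF M this] show ?thesis .
qed

end
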